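(* Let $G$ be a finite graph with vertex set $V$, whose vertices are labeled and whose edges are unlabeled. The vertex labeled minors of $G$ which are simple graphs are in bijection with the minors of the minimally generated lattice of flats $L(G)$, via the map $H\mapsto L(H)$.
   Context: Graphs may have loops and multiple edges; a graph is simple if it has neither. For a graph $\Gamma$ whose vertices are labeled by the blocks of a partition of $V$ (so $V(\Gamma)$ is a set partition of $V$), and a set $A$ of edges of $\Gamma$, let $\pi(A)$ be the partition of $V$ whose blocks are the unions of the labels of the vertices in each connected component of the spanning subgraph $(V(\Gamma),A)$. The lattice $K$ of all such partitions $\pi(A)$, $A\subseteq E(\Gamma)$, ordered by refinement (these correspond to the flats of the graphic matroid of $\Gamma$), together with its set $\operatorname{irr}(K)$ of join irreducibles, is the generator enriched lattice $L(\Gamma)=(K,\operatorname{irr}(K))$. The original graph $G$ is labeled by singletons $\{v\}$, $v\in V$. Vertex labeled minors: deleting an edge removes it; contracting a non-loop edge with endpoints labeled $B_1,B_2$ identifies its endpoints into one vertex labeled $B_1\cup B_2$ (contracting a loop removes it); a vertex labeled minor of $G$ is any vertex labeled graph obtained from $G$ by a finite sequence of edge deletions and contractions (no vertex deletions). Two vertex labeled graphs are considered equal if they have the same labeled vertices and the same edges between labeled vertices (edges are unlabeled). A generator enriched lattice is a pair $(L,G')$ with $L$ a finite lattice and $G'\subseteq L\setminus\{\widehat0\}$ generating $L$ under joins. For $H\subseteq L$ and $z<h$ for all $h\in H$, $\langle H|z\rangle=(\{z\}\cup\{\bigvee_{x\in S}x:\emptyset\ne S\subseteq H\},H)$. For $I\subseteq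 G'$: deletion $(L,G')\setminus I=\langle G'\setminus I|\widehat0_L\rangle$; with $i_0=\bigvee I$ and $J=\{g\vee i_0:g\in G'\}\setminus\{i_0\}$, contraction $(L,G')/I=\langle J|i_0\rangle$. A minor is the result of any finite sequence of deletions and contractions. Minors of $L(G)$ are thus generator enriched lattices whose elements are partitions of $V$. *)

theory Defs
  imports
    "HOL-Algebra.Lattice"
    "HOL-Library.Multiset"
    "HOL-Library.Uprod"
    "HOL-Library.Disjoint_Sets"
begin

section \<open>Vertex labeled graphs\<close>

text \<open>Vertices are identified with their labels, which are sets of elements of \<open>'v\<close>. Edges are
  unlabeled, so they form a multiset of unordered pairs of vertices, a loop at \<open>B\<close> being
  \<open>Upair B B\<close>. Equality of records is then the intended equality of vertex labeled graphs.\<close>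

record 'v vlgraph =
  verts :: "'v set set"
  edges :: "'v set uprod multiset"

definition singleton_labeled :: "'v set \<Rightarrow> 'v uprod multiset \<Rightarrow> 'v vlgraph" where
  "singleton_labeled V E =
     \<lparr>verts = (\<lambda>v. {v}) ` V, edges = image_mset (map_uprod (\<lambda>v. {v})) E\<rparr>"

definition simple_graph :: "'v vlgraph \<Rightarrow> bool" where
  "simple_graph \<Gamma> \<longleftrightarrow>
     (\<forall>e \<in># edges \<Gamma>. proper_uprod e) \<and> (\<forall>e. count (edges \<Gamma>) e \<le> 1)"

definition delete_edge :: "'v set uprod \<Rightarrow> 'v vlgraph \<Rightarrow> 'v vlgraph" where
  "delete_edge e \<Gamma> = \<Gamma>\<lparr>edges := edges \<Gamma> - {#e#}\<rparr>"

text \<open>For a loop the relabeling below is the identity, so that contracting a loop just removes it.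
  Contracting a non-loop edge turns the edges parallel to it into loops.\<close>

definition merge_ends :: "'v set uprod \<Rightarrow> 'v set \<Rightarrow> 'v set" where
  "merge_ends e B = (if B \<in> set_uprod e then \<Union>(set_uprod e) else B)"

definition contract_edge :: "'v set uprod \<Rightarrow> 'v vlgraph \<Rightarrow> 'v vlgraph" where
  "contract_edge e \<Gamma> =
     \<lparr>verts = merge_ends e ` verts \<Gamma>,
      edges = image_mset (map_uprod (merge_ends e)) (edges \<Gamma> - {#e#})\<rparr>"

inductive vl_minor :: "'v vlgraph \<Rightarrow> 'v vlgraph \<Rightarrow> bool" for \<Gamma> where
  self: "vl_minor \<Gamma> \<Gamma>"
| deletion: "vl_minor \<Gamma> H \<Longrightarrow> e \<in># edges H \<Longrightarrow> vl_minor \<Gamma> (delete_edge e H)"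
| contraction: "vl_minor \<Gamma> H \<Longrightarrow> e \<in># edges H \<Longrightarrow> vl_minor \<Gamma> (contract_edge e H)"


section \<open>Generator enriched lattices\<close>

record 'a gelattice = "'a gorder" +
  gens :: "'a set"

text \<open>\<open>gen_by L H z\<close> is \<open>\<langle>H|z\<rangle>\<close>, with joins taken in \<open>L\<close> and the order inherited from \<open>L\<close>.\<close>

definition gen_by :: "'a gelattice \<Rightarrow> 'a set \<Rightarrow> 'a \<Rightarrow> 'a gelattice" where
  "gen_by L H z =
     L\<lparr>carrier := {z} \<union> {\<Squnion>\<^bsub>L\<^esub> S | S. S \<noteq> {} \<and> S \<subseteq> H}, gens := H\<rparr>"

definition gel_delete :: "'a gelattice \<Rightarrow> 'a set \<Rightarrow> 'a gelattice" where
  "gel_delete L I = gen_by L (gens L - I) \<bottom>\<^bsub>L\<^esub>"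

definition gel_contract :: "'a gelattice \<Rightarrow> 'a set \<Rightarrow> 'a gelattice" where
  "gel_contract L I =
     (let i\<^sub>0 = \<Squnion>\<^bsub>L\<^esub> I in gen_by L ({g \<squnion>\<^bsub>L\<^esub> i\<^sub>0 | g. g \<in> gens L} - {i\<^sub>0}) i\<^sub>0)"

inductive gel_minor :: "'a gelattice \<Rightarrow> 'a gelattice \<Rightarrow> bool" for L where
  self: "gel_minor L L"
| deletion: "gel_minor L M \<Longrightarrow> I \<subseteq> gens M \<Longrightarrow> gel_minor L (gel_delete M I)"
| contraction: "gel_minor L M \<Longrightarrow> I \<subseteq> gens M \<Longrightarrow> gel_minor L (gel_contract M I)"

definition join_irreducibles :: "('a, 'b) gorder_scheme \<Rightarrow> 'a set" where
  "join_irreducibles L =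
     {x \<in> carrier L. x \<noteq> \<bottom>\<^bsub>L\<^esub> \<and>
        (\<forall>a \<in> carrier L. \<forall>b \<in> carrier L. x = a \<squnion>\<^bsub>L\<^esub> b \<longrightarrow> x = a \<or> x = b)}"


section \<open>The minimally generated lattice of flats\<close>

definition connected_rel :: "'v vlgraph \<Rightarrow> 'v set uprod multiset \<Rightarrow> ('v set \<times> 'v set) set" where
  "connected_rel \<Gamma> A =
     {(B, C) \<in> verts \<Gamma> \<times> verts \<Gamma>. (B, C) \<in> {(X, Y). Upair X Y \<in># A}\<^sup>*}"

definition component_partition :: "'v vlgraph \<Rightarrow> 'v set uprod multiset \<Rightarrow> 'v set set" where
  "component_partition \<Gamma> A = Union ` (verts \<Gamma> // connected_rel \<Gamma> A)"

definition flats_order :: "'v vlgraph \<Rightarrow> 'v set set gorder" where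
  "flats_order \<Gamma> =
     \<lparr>carrier = {component_partition \<Gamma> A | A. A \<subseteq># edges \<Gamma>},
      eq = (=),
      le = refines (\<Union>(verts \<Gamma>))\<rparr>"

definition lattice_of_flats :: "'v vlgraph \<Rightarrow> 'v set set gelattice" where
  "lattice_of_flats \<Gamma> =
     gorder.extend (flats_order \<Gamma>) \<lparr>gens = join_irreducibles (flats_order \<Gamma>)\<rparr>"

end

theory Submission
  imports Defs
begin

text \<open>The partition \<open>\<pi>(A)\<close> is the finest partition of \<open>V\<close> that is coarser than the vertex labels
  and keeps the two ends of each edge of \<open>A\<close> in one block. Hence joins of flats are given by unions
  of edge sets, and the join irreducibles are the atoms \<open>\<pi>({e})\<close> with \<open>e\<close> not a loop. Deleting the
  generators \<open>I\<close> of \<open>L(H)\<close> amounts to deleting all edges \<open>e\<close> with \<open>\<pi>({e}) \<in> I\<close>, contracting \<open>I\<close>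
  amounts to contracting these edges, and every edge deletion or contraction is seen in this way, so
  the minors of \<open>L(G)\<close> are the lattices \<open>L(H)\<close> of the vertex labeled minors. Loops and parallel edges
  do not affect \<open>L(H)\<close>, and a simple \<open>H\<close> is recovered from \<open>L(H)\<close>: the vertices form the bottom
  element, and an atom merges exactly the two ends of its edge.\<close>

section \<open>Component partitions\<close>

text \<open>The invariant carried through all minors. The ground set \<open>V\<close> never changes,
  since vertices are merged but not deleted.\<close>

definition labeled_graph :: "'v set \<Rightarrow> 'v vlgraph \<Rightarrow> bool" where
  "labeled_graph V \<Gamma> \<longleftrightarrow>
     partition_on V (verts \<Gamma>) \<and> (\<forall>e \<in># edges \<Gamma>. set_uprod e \<subseteq> verts \<Gamma>)"

text \<open>Stated by inclusion, because \<open>Q\<close> is usually coarser than the vertex set and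
  its blocks are then unions of labels.\<close>

definition confines :: "'v set set \<Rightarrow> 'v set uprod \<Rightarrow> bool" where
  "confines Q e \<longleftrightarrow> (\<exists>Y \<in> Q. \<Union>(set_uprod e) \<subseteq> Y)"

lemma confines_Upair: "confines Q (Upair B C) \<longleftrightarrow> (\<exists>Y \<in> Q. B \<subseteq> Y \<and> C \<subseteq> Y)"
  by (auto simp: confines_def)

lemma partition_on_block_eq:
  assumes "partition_on V Q" "Y \<in> Q" "Z \<in> Q" "X \<noteq> {}" "X \<subseteq> Y" "X \<subseteq> Z"
  shows "Y = Z"
proof (rule ccontr)
  assume "Y \<noteq> Z"
  with assms(1-3) have "Y \<inter> Z = {}"
    by (auto simp: partition_on_def disjoint_def)
  with assms(4-6) show False by blast
qed

text \<open>Taking \<open>R\<close> to be \<open>P\<close> and then \<open>Q\<close> gives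
  refinement both ways. A partition is thus known from its coarsenings, which is the form in which
  the universal property of flats is applied.\<close>

lemma refines_eqI:
  assumes "partition_on V P" "partition_on V Q"
    and "\<And>R. partition_on V R \<Longrightarrow> refines V P R \<longleftrightarrow> refines V Q R"
  shows "P = Q"
  using assms refines_refl refines_asym by metis

lemma confines_mono: "confines P e \<Longrightarrow> refines V P Q \<Longrightarrow> confines Q e"
  by (meson confines_def order_trans refines_def)

text \<open>Blocks are nonempty and pairwise disjoint, so a block of \<open>P\<close> containing
  both ends equals each of them. This is why loops are invisible to flats.\<close>

lemma confines_iff_not_proper:
  assumes "partition_on V P" "set_uprod e \<subseteq> P"
  shows "confines P e \<longleftrightarrow> \<not> proper_uprod e"
proof (cases e)
  case (Upair B C)
  have BC: "B \<in> P" "C \<in> P" "B \<noteq> {}" "C \<noteq> {}"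
    using assms Upair by (auto simp: partition_on_def)
  show ?thesis
  proof
    assume "confines P e"
    then obtain Y where "Y \<in> P" "B \<subseteq> Y" "C \<subseteq> Y" by (auto simp: Upair confines_Upair)
    then have "B = Y" "C = Y"
      using partition_on_block_eq[OF assms(1)] BC by blast+
    then show "\<not> proper_uprod e" by (simp add: Upair)
  next
    assume "\<not> proper_uprod e"
    then show "confines P e" using BC by (auto simp: Upair confines_Upair)
  qed
qed

section \<open>Connected components as a partition of the ground set\<close>

lemma Upair_commute: "Upair B C = Upair C B"
  by simp

lemma equiv_connected_rel: "equiv (verts \<Gamma>) (connected_rel \<Gamma> A)"
proof -
  have "sym {(X, Y). Upair X Y \<in># A}"
    by (rule symI) (simp add: Upair_commute)
  then have s: "sym ({(X, Y). Upair X Y \<in># A}\<^sup>*)" by (rule sym_rtrancl)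
  show ?thesis
    by (rule equivI)
      (use s in \<open>auto simp: connected_rel_def refl_on_def sym_def trans_def intro: rtrancl_trans\<close>)
qed

text \<open>Disjoint classes of blocks have disjoint unions, because the blocks themselves are
  disjoint. The classes will be the vertex sets of connected components.\<close>

lemma partition_on_Union_image:
  assumes "partition_on V P" "partition_on P \<C>"
  shows "partition_on V (Union ` \<C>)"
proof (rule partition_onI)
  show "\<Union>(Union ` \<C>) = V"
    using assms by (auto simp: partition_on_def)
  have sub: "C \<subseteq> P" if "C \<in> \<C>" for C
    using assms(2) that by (auto simp: partition_on_def)
  have "\<Union>C \<noteq> {}" if C: "C \<in> \<C>" for C
  proof -
    obtain B where "B \<in> C" "B \<in> P"
      using assms(2) sub[OF C] C by (metis all_not_in_conv partition_on_def subsetD)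
    moreover from this have "B \<noteq> {}" using assms(1) by (auto simp: partition_on_def)
    ultimately show ?thesis by blast
  qed
  then show "{} \<notin> Union ` \<C>" by (metis imageE)
  fix X Y assume XY: "X \<in> Union ` \<C>" "Y \<in> Union ` \<C>" "X \<noteq> Y"
  then obtain C D where C: "C \<in> \<C>" "X = \<Union>C" and D: "D \<in> \<C>" "Y = \<Union>D" by blast
  have "C \<inter> D = {}" using C D XY assms(2) by (auto simp: partition_on_def disjoint_def)
  then have "B \<inter> B' = {}" if "B \<in> C" "B' \<in> D" for B B'
    using assms(1) that sub[OF C(1)] sub[OF D(1)] partition_on_def disjointD
    by (metis disjoint_iff subsetD)
  then show "disjnt X Y" using C D by (auto simp: disjnt_def)
qed

lemma partition_on_component_partition:
  "partition_on V (verts \<Gamma>) \<Longrightarrow> partition_on V (component_partition \<Gamma> A)"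
  unfolding component_partition_def
  by (rule partition_on_Union_image[OF _ partition_on_quotient[OF equiv_connected_rel]])

text \<open>This universal property determines the component partition by antisymmetry, so nothing
  below looks at connectedness again.\<close>

lemma refines_component_partition_iff:
  assumes P: "partition_on V (verts \<Gamma>)" and A: "\<forall>e \<in># A. set_uprod e \<subseteq> verts \<Gamma>"
  shows "refines V (component_partition \<Gamma> A) Q \<longleftrightarrow>
    refines V (verts \<Gamma>) Q \<and> (\<forall>e \<in># A. confines Q e)"
proof
  let ?\<pi> = "component_partition \<Gamma> A" and ?r = "connected_rel \<Gamma> A"
  have \<pi>: "partition_on V ?\<pi>" by (rule partition_on_component_partition[OF P])
  have block: "\<Union>(?r `` {B}) \<in> ?\<pi>" "B \<in> ?r `` {B}" if "B \<in> verts \<Gamma>" for B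
    using that equiv_class_self[OF equiv_connected_rel]
    unfolding component_partition_def by (blast intro: quotientI)+
  {
    assume ref: "refines V ?\<pi> Q"
    have "refines V (verts \<Gamma>) ?\<pi>"
      unfolding refines_def using P \<pi> block by blast
    moreover have "confines ?\<pi> e" if "e \<in># A" for e
    proof (cases e)
      case (Upair B C)
      then have "B \<in> verts \<Gamma>" "C \<in> verts \<Gamma>" using A that by auto
      moreover from this have "C \<in> ?r `` {B}"
        using that Upair by (auto simp: connected_rel_def)
      ultimately have "B \<subseteq> \<Union>(?r `` {B})" "C \<subseteq> \<Union>(?r `` {B})" "\<Union>(?r `` {B}) \<in> ?\<pi>"
        using block[of B] by (simp_all add: Union_upper)
      then show ?thesis unfolding Upair confines_Upair by metis
    qed
    ultimately show "refines V (verts \<Gamma>) Q \<and> (\<forall>e \<in># A. confines Q e)"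
      using ref refines_trans confines_mono by metis
  next
    assume R: "refines V (verts \<Gamma>) Q \<and> (\<forall>e \<in># A. confines Q e)"
    then have Q: "partition_on V Q" by (simp add: refines_def)
    have "\<exists>Z \<in> Q. X \<subseteq> Z" if "X \<in> ?\<pi>" for X
    proof -
      obtain B where B: "B \<in> verts \<Gamma>" "X = \<Union>(?r `` {B})"
        using \<open>X \<in> ?\<pi>\<close> unfolding component_partition_def by (blast elim: quotientE)
      then obtain Z where Z: "Z \<in> Q" "B \<subseteq> Z" using R by (auto simp: refines_def)
      \<comment> \<open>Induction along a path from \<open>B\<close>: the block confining the next
        edge shares the nonempty set \<open>C\<close> with \<open>Z\<close>, so it is
        \<open>Z\<close> and contains \<open>D\<close> too.\<close>
      have "C \<subseteq> Z" if "(B, C) \<in> {(X, Y). Upair X Y \<in># A}\<^sup>*" for C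
        using that
      proof (induction rule: rtrancl_induct)
        case (step C D)
        then have CD: "Upair C D \<in># A" by simp
        then obtain Y where Y: "Y \<in> Q" "C \<subseteq> Y" "D \<subseteq> Y" using R confines_Upair by metis
        have "C \<in> verts \<Gamma>" using CD A by force
        then have "C \<noteq> {}" using P by (auto simp: partition_on_def)
        then have "Y = Z" using partition_on_block_eq[OF Q] Y Z step.IH by blast
        then show ?case using Y by simp
      qed (use Z in simp)
      then have "X \<subseteq> Z" using B(2) by (auto simp: connected_rel_def)
      then show ?thesis using Z by blast
    qed
    then show "refines V ?\<pi> Q" using \<pi> Q by (simp add: refines_def)
  }
qed

section \<open>The lattice of flats\<close>

text \<open>The supremum is defined by choice among least upper bounds; antisymmetry of refinement
  leaves only one candidate. No lattice axioms for \<open>L\<close> are required.\<close>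

lemma sup_eqI:
  assumes "le L = refines V" "S \<subseteq> carrier L" "q \<in> carrier L" "partition_on V q"
    and lub: "\<And>Q. Q \<in> carrier L \<Longrightarrow> refines V q Q \<longleftrightarrow> (\<forall>s \<in> S. refines V s Q)"
  shows "\<Squnion>\<^bsub>L\<^esub> S = q"
proof -
  have U: "Upper L S = {u \<in> carrier L. \<forall>s \<in> S. refines V s u}"
    using assms(1,2) by (auto simp: Upper_def)
  have q: "least L q (Upper L S)"
    using assms(1,3) lub refines_refl[OF assms(4)] by (auto simp: least_def U)
  show ?thesis
    unfolding sup_def
  proof (rule some_equality)
    show "least L q (Upper L S)" by (fact q)
    fix x assume "least L x (Upper L S)"
    with q have "refines V x q" "refines V q x" using assms(1) by (auto simp: least_def)
    then show "x = q" by (rule refines_asym)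
  qed
qed

lemma bottom_eqI:
  assumes "le L = refines V" "q \<in> carrier L" "\<And>Q. Q \<in> carrier L \<Longrightarrow> refines V q Q"
  shows "\<bottom>\<^bsub>L\<^esub> = q"
  unfolding bottom_def
proof (rule some_equality)
  show q: "least L q (carrier L)" using assms by (auto simp: least_def)
  fix x assume "least L x (carrier L)"
  with q have "refines V x q" "refines V q x" using assms(1) by (auto simp: least_def)
  then show "x = q" by (rule refines_asym)
qed

lemma lattice_of_flats_simps:
  "carrier (lattice_of_flats \<Gamma>) = carrier (flats_order \<Gamma>)"
  "le (lattice_of_flats \<Gamma>) = refines (\<Union>(verts \<Gamma>))"
  "eq (lattice_of_flats \<Gamma>) = (=)"
  "gens (lattice_of_flats \<Gamma>) = join_irreducibles (flats_order \<Gamma>)"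
  by (simp_all add: lattice_of_flats_def flats_order_def gorder.defs)

section \<open>Flats in terms of edge sets, and the flat of a single edge\<close>

context
  fixes V :: "'v set" and \<Gamma> :: "'v vlgraph"
  assumes \<Gamma>: "labeled_graph V \<Gamma>"
begin

lemma labeled_graph_partition: "partition_on V (verts \<Gamma>)"
  using \<Gamma> by (simp add: labeled_graph_def)

lemma labeled_graph_ends: "e \<in># edges \<Gamma> \<Longrightarrow> set_uprod e \<subseteq> verts \<Gamma>"
  using \<Gamma> by (simp add: labeled_graph_def)

lemma partition_on_flat: "partition_on V (component_partition \<Gamma> A)"
  by (rule partition_on_component_partition[OF labeled_graph_partition])

text \<open>Only the underlying sets are compared, so that \<open>A + B\<close> is admissible even
  where its multiplicities exceed those of the graph.\<close>

lemma refines_flat_iff: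
  assumes "set_mset A \<subseteq> set_mset (edges \<Gamma>)"
  shows "refines V (component_partition \<Gamma> A) Q \<longleftrightarrow>
    refines V (verts \<Gamma>) Q \<and> (\<forall>e \<in># A. confines Q e)"
  using assms labeled_graph_ends
  by (intro refines_component_partition_iff[OF labeled_graph_partition]) blast

lemma component_partition_empty: "component_partition \<Gamma> {#} = verts \<Gamma>"
  by (rule refines_eqI[OF partition_on_flat labeled_graph_partition]) (simp add: refines_flat_iff)

text \<open>The universal property does not see multiplicities, and a loop is confined by every
  partition coarser than the vertices.\<close>

lemma component_partition_cong:
  assumes "set_mset A \<subseteq> set_mset (edges \<Gamma>)" "set_mset B \<subseteq> set_mset (edges \<Gamma>)"
    and "\<And>e. proper_uprod e \<Longrightarrow> e \<in># A \<longleftrightarrow> e \<in># B"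
  shows "component_partition \<Gamma> A = component_partition \<Gamma> B"
proof -
  have loop: "confines Q e"
    if "e \<in># edges \<Gamma>" "\<not> proper_uprod e" "refines V (verts \<Gamma>) Q" for e Q
    using confines_mono[OF _ that(3)] that(2) labeled_graph_ends[OF that(1)]
    by (simp add: confines_iff_not_proper[OF labeled_graph_partition])
  have "(\<forall>e \<in># A. confines Q e) \<longleftrightarrow> (\<forall>e \<in># B. confines Q e)" if "refines V (verts \<Gamma>) Q" for Q
    using loop[OF _ _ that] assms by blast
  then have "refines V (component_partition \<Gamma> A) Q \<longleftrightarrow> refines V (component_partition \<Gamma> B) Q" for Q
    unfolding refines_flat_iff[OF assms(1)] refines_flat_iff[OF assms(2)] by blast
  then show ?thesis
    by (intro refines_eqI[OF partition_on_flat partition_on_flat])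
qed

lemma confines_flat: "e \<in># A \<Longrightarrow> set_mset A \<subseteq> set_mset (edges \<Gamma>) \<Longrightarrow>
    confines (component_partition \<Gamma> A) e"
  using refines_flat_iff[of A "component_partition \<Gamma> A"] refines_refl[OF partition_on_flat[of A]]
  by simp

lemma refines_verts_flat: "set_mset A \<subseteq> set_mset (edges \<Gamma>) \<Longrightarrow>
    refines V (verts \<Gamma>) (component_partition \<Gamma> A)"
  using refines_flat_iff[of A "component_partition \<Gamma> A"] refines_refl[OF partition_on_flat[of A]]
  by simp

text \<open>The flat of \<open>e\<close> confines \<open>e\<close>, but the vertex partition
  confines loops only; conversely a loop contributes as little as the empty set.\<close>

lemma component_partition_edge_eq_verts_iff:
  assumes "e \<in># edges \<Gamma>"
  shows "component_partition \<Gamma> {#e#} = verts \<Gamma> \<longleftrightarrow> \<not> proper_uprod e"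
proof
  assume "component_partition \<Gamma> {#e#} = verts \<Gamma>"
  then have "confines (verts \<Gamma>) e" using confines_flat[of e "{#e#}"] assms by simp
  then show "\<not> proper_uprod e"
    by (simp add: confines_iff_not_proper[OF labeled_graph_partition labeled_graph_ends[OF assms]])
next
  assume "\<not> proper_uprod e"
  then have "component_partition \<Gamma> {#e#} = component_partition \<Gamma> {#}"
    using assms by (intro component_partition_cong) auto
  then show "component_partition \<Gamma> {#e#} = verts \<Gamma>" by (simp add: component_partition_empty)
qed

lemma partition_on_merge_ends:
  assumes "set_uprod e \<subseteq> verts \<Gamma>"
  shows "partition_on V (merge_ends e ` verts \<Gamma>)"
proof (cases e)
  case (Upair B C)
  have BC: "B \<in> verts \<Gamma>" "C \<in> verts \<Gamma>" using assms Upair by auto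
  \<comment> \<open>This covers loops as well: then \<open>B = C\<close>, and \<open>insert\<close>
    puts \<open>B\<close> back.\<close>
  have eq: "merge_ends e ` verts \<Gamma> = insert (B \<union> C) (verts \<Gamma> - {B, C})"
    using BC by (auto simp: merge_ends_def Upair image_iff)
  have P: "{} \<notin> verts \<Gamma>" "\<Union>(verts \<Gamma>) = V"
    "\<And>X Y. X \<in> verts \<Gamma> \<Longrightarrow> Y \<in> verts \<Gamma> \<Longrightarrow> X \<noteq> Y \<Longrightarrow> X \<inter> Y = {}"
    using labeled_graph_partition by (auto simp: partition_on_def disjoint_def)
  have disj: "D \<inter> (B \<union> C) = {}" if "D \<in> verts \<Gamma> - {B, C}" for D
    using P(3)[of D B] P(3)[of D C] BC that by blast
  show ?thesis
    unfolding eq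
  proof (rule partition_onI)
    show "\<Union>(insert (B \<union> C) (verts \<Gamma> - {B, C})) = V"
      using BC P(2) by blast
    show "{} \<notin> insert (B \<union> C) (verts \<Gamma> - {B, C})" using BC P(1) by auto
    fix X Y assume "X \<in> insert (B \<union> C) (verts \<Gamma> - {B, C})"
      "Y \<in> insert (B \<union> C) (verts \<Gamma> - {B, C})" "X \<noteq> Y"
    then show "disjnt X Y" using P(3)[of X Y] disj[of X] disj[of Y] unfolding disjnt_def by blast
  qed
qed

text \<open>Both partitions have the same coarsenings. This identifies the flat of one edge with the
  vertex set produced by \<open>contract_edge\<close>.\<close>

lemma component_partition_edge:
  assumes "e \<in># edges \<Gamma>"
  shows "component_partition \<Gamma> {#e#} = merge_ends e ` verts \<Gamma>"
proof (rule refines_eqI[OF partition_on_flat])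
  have e: "set_uprod e \<subseteq> verts \<Gamma>" using labeled_graph_ends assms .
  then show M: "partition_on V (merge_ends e ` verts \<Gamma>)" by (rule partition_on_merge_ends)
  fix R assume R: "partition_on V R"
  have "(\<forall>B \<in> verts \<Gamma>. \<exists>Y \<in> R. merge_ends e B \<subseteq> Y) \<longleftrightarrow>
      (\<forall>B \<in> verts \<Gamma>. \<exists>Y \<in> R. B \<subseteq> Y) \<and> confines R e" (is "?l \<longleftrightarrow> ?r")
  proof
    assume l: ?l
    obtain B where B: "B \<in> set_uprod e" by (cases e) auto
    then obtain Y where "Y \<in> R" "merge_ends e B \<subseteq> Y" using l e by blast
    then have "confines R e" using B unfolding merge_ends_def confines_def by auto
    moreover have "B \<subseteq> merge_ends e B" for B by (auto simp: merge_ends_def)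
    ultimately show ?r using l by (meson order_trans)
  qed (auto simp: merge_ends_def confines_def)
  then show "refines V (component_partition \<Gamma> {#e#}) R \<longleftrightarrow> refines V (merge_ends e ` verts \<Gamma>) R"
    using assms R M labeled_graph_partition refines_flat_iff[of "{#e#}" R]
    by (simp add: refines_def[of V "verts \<Gamma>"] refines_def[of V "merge_ends e ` verts \<Gamma>"])
qed

text \<open>At most one block of the flat of \<open>e\<close> is not a vertex, namely the union of
  the ends of \<open>e\<close>, so two distinct vertices in one block are these ends. This yields
  both the minimality of atoms and the recovery of edges from atoms.\<close>

lemma confines_component_partition_edge:
  assumes e: "e \<in># edges \<Gamma>" and f: "set_uprod f \<subseteq> verts \<Gamma>" "proper_uprod f"
    and "confines (component_partition \<Gamma> {#e#}) f"
  shows "f = e"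
proof (cases e; cases f)
  fix B C X Y assume eq: "e = Upair B C" "f = Upair X Y"
  have mem: "B \<in> verts \<Gamma>" "C \<in> verts \<Gamma>" "X \<in> verts \<Gamma>" "Y \<in> verts \<Gamma>" "X \<noteq> Y"
    using labeled_graph_ends[OF e] f eq by auto
  have P: "{} \<notin> verts \<Gamma>"
    "\<And>X Y. X \<in> verts \<Gamma> \<Longrightarrow> Y \<in> verts \<Gamma> \<Longrightarrow> X \<noteq> Y \<Longrightarrow> X \<inter> Y = {}"
    using labeled_graph_partition by (auto simp: partition_on_def disjoint_def)
  have sub: "D = B \<or> D = C" if "D \<in> verts \<Gamma>" "D \<subseteq> B \<union> C" for D
  proof (rule ccontr)
    assume "\<not> ?thesis"
    then have "D \<inter> B = {}" "D \<inter> C = {}" using P(2) that mem by blast+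
    with that have "D = {}" by blast
    with P(1) that show False by simp
  qed
  obtain Z where Z: "Z \<in> verts \<Gamma>" "X \<subseteq> merge_ends e Z" "Y \<subseteq> merge_ends e Z"
    using assms(4) unfolding component_partition_edge[OF e] eq(2) confines_Upair by blast
  show "f = e"
  proof (cases "Z \<in> {B, C}")
    case True
    then have "X \<subseteq> B \<union> C" "Y \<subseteq> B \<union> C" using Z by (auto simp: merge_ends_def eq)
    then have "X = B \<or> X = C" "Y = B \<or> Y = C" using sub mem by blast+
    then show ?thesis using mem(5) unfolding eq Upair_inject by metis
  next
    case False
    then have "X \<subseteq> Z" "Y \<subseteq> Z" using Z by (auto simp: merge_ends_def eq)
    moreover have "X \<noteq> {}" "Y \<noteq> {}" using mem P(1) by metis+
    ultimately have "X = Z" "Y = Z" using P(2) Z(1) mem by blast+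
    then show ?thesis using mem by simp
  qed
qed

section \<open>Joins, bottom and join irreducibles of the flats\<close>

lemma Union_verts: "\<Union>(verts \<Gamma>) = V"
  using labeled_graph_partition by (simp add: partition_on_def)

lemma carrier_flats_order:
  "carrier (flats_order \<Gamma>) = {component_partition \<Gamma> A | A. set_mset A \<subseteq> set_mset (edges \<Gamma>)}"
proof -
  have "\<exists>B. component_partition \<Gamma> A = component_partition \<Gamma> B \<and> B \<subseteq># edges \<Gamma>"
    if "set_mset A \<subseteq> set_mset (edges \<Gamma>)" for A
  proof (intro exI conjI)
    let ?B = "filter_mset (\<lambda>e. e \<in># A) (edges \<Gamma>)"
    show "component_partition \<Gamma> A = component_partition \<Gamma> ?B"
      using that by (intro component_partition_cong) auto
  qed simp
  then show ?thesis
    unfolding flats_order_def by (auto dest: set_mset_mono)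
qed

lemma refines_verts_carrier: "Q \<in> carrier (flats_order \<Gamma>) \<Longrightarrow> refines V (verts \<Gamma>) Q"
  using refines_verts_flat unfolding carrier_flats_order by blast

text \<open>\<open>L\<close> is a parameter because joins are needed both in
  \<open>flats_order\<close>, where irreducibility is defined, and in
  \<open>lattice_of_flats\<close>.\<close>

lemma sup_flats:
  assumes "carrier L = carrier (flats_order \<Gamma>)" "le L = refines V" "S \<subseteq> carrier L"
    and "set_mset A \<subseteq> set_mset (edges \<Gamma>)"
    and "\<And>Q. refines V (verts \<Gamma>) Q \<Longrightarrow>
      (\<forall>e \<in># A. confines Q e) \<longleftrightarrow> (\<forall>s \<in> S. refines V s Q)"
  shows "\<Squnion>\<^bsub>L\<^esub> S = component_partition \<Gamma> A"
proof (rule sup_eqI[OF assms(2,3) _ partition_on_flat])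
  show "component_partition \<Gamma> A \<in> carrier L"
    unfolding assms(1) carrier_flats_order using assms(4) by blast
  fix Q assume "Q \<in> carrier L"
  then have "refines V (verts \<Gamma>) Q" using assms(1) refines_verts_carrier by simp
  then show "refines V (component_partition \<Gamma> A) Q \<longleftrightarrow> (\<forall>s \<in> S. refines V s Q)"
    using assms(5) refines_flat_iff[OF assms(4)] by simp
qed

lemma join_flats:
  assumes "carrier L = carrier (flats_order \<Gamma>)" "le L = refines V"
    and A: "set_mset A \<subseteq> set_mset (edges \<Gamma>)" and B: "set_mset B \<subseteq> set_mset (edges \<Gamma>)"
  shows "component_partition \<Gamma> A \<squnion>\<^bsub>L\<^esub> component_partition \<Gamma> B = component_partition \<Gamma> (A + B)"
  unfolding join_def
proof (rule sup_flats[OF assms(1,2)])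
  show "{component_partition \<Gamma> A, component_partition \<Gamma> B} \<subseteq> carrier L"
    unfolding assms(1) carrier_flats_order using A B by blast
  show "set_mset (A + B) \<subseteq> set_mset (edges \<Gamma>)" using A B by simp
  fix Q assume "refines V (verts \<Gamma>) Q"
  then show "(\<forall>e \<in># A + B. confines Q e) \<longleftrightarrow>
      (\<forall>s \<in> {component_partition \<Gamma> A, component_partition \<Gamma> B}. refines V s Q)"
    using refines_flat_iff[OF A] refines_flat_iff[OF B] by auto
qed

lemma bottom_flats:
  assumes "carrier L = carrier (flats_order \<Gamma>)" "le L = refines V"
  shows "\<bottom>\<^bsub>L\<^esub> = verts \<Gamma>"
proof (rule bottom_eqI[OF assms(2)])
  show "verts \<Gamma> \<in> carrier L"
    unfolding assms(1) carrier_flats_order using component_partition_empty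
    by (metis (mono_tags, lifting) empty_subsetI mem_Collect_eq set_mset_empty)
qed (simp add: assms(1) refines_verts_carrier)

text \<open>Every flat is built by joining flats of single edges, so an irreducible one is such a
  flat. Conversely, the flat of a proper edge has only the bottom strictly below it.\<close>

lemma join_irreducibles_flats_order:
  "join_irreducibles (flats_order \<Gamma>) =
    {component_partition \<Gamma> {#e#} | e. e \<in># edges \<Gamma> \<and> proper_uprod e}"
proof -
  let ?L = "flats_order \<Gamma>" and ?\<pi> = "component_partition \<Gamma>" and ?E = "set_mset (edges \<Gamma>)"
  have le: "le ?L = refines V" by (simp add: flats_order_def Union_verts)
  have join: "?\<pi> A \<squnion>\<^bsub>?L\<^esub> ?\<pi> B = ?\<pi> (A + B)" if "set_mset A \<subseteq> ?E" "set_mset B \<subseteq> ?E" for A B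
    using join_flats[OF refl le that] .
  have flat: "?\<pi> A \<in> carrier ?L" if "set_mset A \<subseteq> ?E" for A
    unfolding carrier_flats_order using that by blast
  have bot: "\<bottom>\<^bsub>?L\<^esub> = verts \<Gamma>" by (rule bottom_flats[OF refl le])
  show ?thesis
  proof (intro equalityI subsetI)
    fix x assume "x \<in> join_irreducibles ?L"
    then have x: "x \<in> carrier ?L" "x \<noteq> verts \<Gamma>"
      "\<And>a b. a \<in> carrier ?L \<Longrightarrow> b \<in> carrier ?L \<Longrightarrow> x = a \<squnion>\<^bsub>?L\<^esub> b \<Longrightarrow> x = a \<or> x = b"
      unfolding join_irreducibles_def bot by blast+
    \<comment> \<open>Splitting off one edge at a time, irreducibility selects either that edge or
      the rest; the empty rest would make \<open>x\<close> the bottom.\<close>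
    have ex: "\<exists>e \<in># A. x = ?\<pi> {#e#}" if "set_mset A \<subseteq> ?E" "x = ?\<pi> A" for A
      using that
    proof (induction A)
      case empty
      then show ?case using x(2) component_partition_empty by simp
    next
      case (add e A)
      have e: "set_mset {#e#} \<subseteq> ?E" and A: "set_mset A \<subseteq> ?E" using add.prems(1) by simp_all
      have "x = ?\<pi> {#e#} \<squnion>\<^bsub>?L\<^esub> ?\<pi> A" using add.prems(2) join[OF e A] by simp
      then have "x = ?\<pi> {#e#} \<or> x = ?\<pi> A" using x(3) flat[OF e] flat[OF A] by blast
      then show ?case using add.IH[OF A] by auto
    qed
    obtain A where A: "set_mset A \<subseteq> ?E" "x = ?\<pi> A" using x(1) unfolding carrier_flats_order by blast
    with ex obtain e where e: "e \<in># A" "x = ?\<pi> {#e#}" by blast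
    then have "e \<in># edges \<Gamma>" using A by blast
    moreover from this have "proper_uprod e"
      using component_partition_edge_eq_verts_iff x(2) e(2) by blast
    ultimately show "x \<in> {?\<pi> {#e#} | e. e \<in># edges \<Gamma> \<and> proper_uprod e}" using e(2) by blast
  next
    fix x assume "x \<in> {?\<pi> {#e#} | e. e \<in># edges \<Gamma> \<and> proper_uprod e}"
    then obtain e where e: "e \<in># edges \<Gamma>" "proper_uprod e" "x = ?\<pi> {#e#}" by blast
    \<comment> \<open>\<open>x\<close> is an atom: a flat below \<open>x\<close> can use no proper
      edge besides \<open>e\<close>.\<close>
    have below: "?\<pi> A = x \<or> ?\<pi> A = verts \<Gamma>"
      if A: "set_mset A \<subseteq> ?E" and "refines V (?\<pi> A) x" for A
    proof -
      have f: "f = e" if "f \<in># A" "proper_uprod f" for f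
      proof (rule confines_component_partition_edge[OF e(1) _ that(2)])
        show "set_uprod f \<subseteq> verts \<Gamma>" using that A by (intro labeled_graph_ends) blast
        show "confines (?\<pi> {#e#}) f"
          using \<open>refines V (?\<pi> A) x\<close> that e(3) refines_flat_iff[OF A, of x] by simp
      qed
      show ?thesis
      proof (cases "e \<in># A")
        case True
        have "?\<pi> A = ?\<pi> {#e#}"
        proof (rule component_partition_cong)
          show "g \<in># A \<longleftrightarrow> g \<in># {#e#}" if "proper_uprod g" for g
            using f[of g] that True by auto
        qed (use A e(1) in simp_all)
        then show ?thesis using e(3) by simp
      next
        case False
        have "?\<pi> A = ?\<pi> {#}"
        proof (rule component_partition_cong)
          show "g \<in># A \<longleftrightarrow> g \<in># {#}" if "proper_uprod g" for g
            using f[of g] that False by auto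
        qed (use A in simp_all)
        then show ?thesis by (simp add: component_partition_empty)
      qed
    qed
    have "x = a \<or> x = b"
      if ab: "a \<in> carrier ?L" "b \<in> carrier ?L" "x = a \<squnion>\<^bsub>?L\<^esub> b" for a b
    proof -
      obtain A B where A: "set_mset A \<subseteq> ?E" "a = ?\<pi> A" and B: "set_mset B \<subseteq> ?E" "b = ?\<pi> B"
        using ab unfolding carrier_flats_order by blast
      have AB: "set_mset (A + B) \<subseteq> ?E" using A B by simp
      have x: "x = ?\<pi> (A + B)" using ab(3) join[OF A(1) B(1)] A B by simp
      then have "refines V x x" using refines_refl[OF partition_on_flat] by simp
      then have "refines V a x" "refines V b x"
        using refines_flat_iff[OF AB, of x] refines_flat_iff[OF A(1), of x]
          refines_flat_iff[OF B(1), of x] A(2) B(2) x by simp_all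
      then have "a = x \<or> a = verts \<Gamma>" "b = x \<or> b = verts \<Gamma>" using below A B by blast+
      \<comment> \<open>If both were the bottom, their join \<open>x\<close> would be too, but
        \<open>e\<close> is proper.\<close>
      moreover have False if "a = verts \<Gamma>" "b = verts \<Gamma>"
      proof -
        have "?\<pi> {#} \<squnion>\<^bsub>?L\<^esub> ?\<pi> {#} = verts \<Gamma>" using join[of "{#}" "{#}"] component_partition_empty by simp
        then have "x = verts \<Gamma>" using that ab(3) component_partition_empty by simp
        then show False using component_partition_edge_eq_verts_iff[OF e(1)] e by simp
      qed
      ultimately show ?thesis by blast
    qed
    moreover have "x \<noteq> verts \<Gamma>" using component_partition_edge_eq_verts_iff[OF e(1)] e by simp
    moreover have "x \<in> carrier ?L" using flat[of "{#e#}"] e by simp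
    ultimately show "x \<in> join_irreducibles ?L"
      unfolding join_irreducibles_def bot by blast
  qed
qed

lemma gens_lattice_of_flats:
  "gens (lattice_of_flats \<Gamma>) =
    {component_partition \<Gamma> {#e#} | e. e \<in># edges \<Gamma> \<and> proper_uprod e}"
  by (simp add: lattice_of_flats_simps join_irreducibles_flats_order)

text \<open>Loops in \<open>A\<close> have no atom, but \<open>Q\<close> confines them anyway, being
  coarser than the vertices.\<close>

lemma confines_all_iff_refines_atoms:
  assumes A: "set_mset A \<subseteq> set_mset (edges \<Gamma>)" and Q: "refines V (verts \<Gamma>) Q"
  shows "(\<forall>e \<in># A. confines Q e) \<longleftrightarrow>
    (\<forall>s \<in> {component_partition \<Gamma> {#e#} | e. e \<in># A \<and> proper_uprod e}. refines V s Q)"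
proof -
  have "refines V (component_partition \<Gamma> {#e#}) Q \<longleftrightarrow> confines Q e" if "e \<in># A" for e
    using refines_flat_iff[of "{#e#}" Q] that A Q by auto
  moreover have "confines Q e" if "e \<in># A" "\<not> proper_uprod e" for e
    using confines_mono[OF _ Q] that A
      confines_iff_not_proper[OF labeled_graph_partition labeled_graph_ends] by blast
  ultimately show ?thesis by blast
qed

end

section \<open>Minors of lattices of flats\<close>

text \<open>The common core of deletion and contraction. Joins of atoms of \<Delta> are taken in the
  larger lattice, yet they come out as flats of \<Delta>, because these all belong to the larger
  carrier by \<open>sub\<close>.\<close>

lemma gen_by_lattice_of_flats:
  assumes \<Gamma>: "labeled_graph V \<Gamma>" and \<Delta>: "labeled_graph V \<Delta>"
    and sub: "carrier (flats_order \<Delta>) \<subseteq> carrier (flats_order \<Gamma>)"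
  shows "gen_by (lattice_of_flats \<Gamma>) (gens (lattice_of_flats \<Delta>)) (verts \<Delta>) = lattice_of_flats \<Delta>"
proof -
  let ?L = "lattice_of_flats \<Gamma>" and ?\<pi> = "component_partition \<Delta>"
  let ?G = "gens (lattice_of_flats \<Delta>)" and ?E = "set_mset (edges \<Delta>)"
  define atoms where "atoms A = {?\<pi> {#e#} | e. e \<in># A \<and> proper_uprod e}" for A
  have le: "le ?L = refines V" by (simp add: lattice_of_flats_simps Union_verts[OF \<Gamma>])
  have flat: "?\<pi> A \<in> carrier ?L" if "set_mset A \<subseteq> ?E" for A
    using sub that unfolding lattice_of_flats_simps carrier_flats_order[OF \<Delta>] by blast
  have sup: "\<Squnion>\<^bsub>?L\<^esub> (atoms A) = ?\<pi> A" if A: "set_mset A \<subseteq> ?E" and ne: "atoms A \<noteq> {}" for A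
  proof (rule sup_eqI[OF le _ flat[OF A] partition_on_flat[OF \<Delta>]])
    have edge: "set_mset {#e#} \<subseteq> ?E" if "e \<in># A" for e using that A by auto
    show "atoms A \<subseteq> carrier ?L" using flat[OF edge] unfolding atoms_def by blast
    fix Q
    \<comment> \<open>\<open>Q\<close> need not be coarser than \<open>verts \<Delta>\<close>; one
      atom below \<open>Q\<close> forces it, so nonemptiness of \<open>atoms A\<close> matters
      here.\<close>
    obtain e where e: "e \<in># A" "?\<pi> {#e#} \<in> atoms A" using ne unfolding atoms_def by blast
    have "refines V (verts \<Delta>) Q" if "\<forall>s \<in> atoms A. refines V s Q"
      using refines_flat_iff[OF \<Delta> edge[OF e(1)], of Q] that e(2) by blast
    then show "refines V (?\<pi> A) Q \<longleftrightarrow> (\<forall>s \<in> atoms A. refines V s Q)"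
      using refines_flat_iff[OF \<Delta> A, of Q] confines_all_iff_refines_atoms[OF \<Delta> A, of Q]
      unfolding atoms_def by blast
  qed
  have carrier: "insert (verts \<Delta>) {\<Squnion>\<^bsub>?L\<^esub> S | S. S \<noteq> {} \<and> S \<subseteq> ?G} = carrier (flats_order \<Delta>)"
  proof (intro equalityI subsetI)
    fix x assume "x \<in> insert (verts \<Delta>) {\<Squnion>\<^bsub>?L\<^esub> S | S. S \<noteq> {} \<and> S \<subseteq> ?G}"
    then consider "x = ?\<pi> {#}" | S where "x = \<Squnion>\<^bsub>?L\<^esub> S" "S \<noteq> {}" "S \<subseteq> ?G"
      using component_partition_empty[OF \<Delta>] by blast
    then show "x \<in> carrier (flats_order \<Delta>)"
    proof cases
      case 1
      have "set_mset {#} \<subseteq> ?E" by simp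
      then show ?thesis unfolding 1 carrier_flats_order[OF \<Delta>] by blast
    next
      case 2
      \<comment> \<open>All edges whose flat lies in \<open>S\<close>. Since \<open>S\<close>
        consists of atoms, their atoms are exactly \<open>S\<close>.\<close>
      let ?A = "filter_mset (\<lambda>e. ?\<pi> {#e#} \<in> S) (edges \<Delta>)"
      have A: "set_mset ?A \<subseteq> ?E" by auto
      have "atoms ?A = S"
        using 2(3) unfolding gens_lattice_of_flats[OF \<Delta>] atoms_def by auto
      then have "x = ?\<pi> ?A" using sup[OF A] 2 by simp
      then show ?thesis using A unfolding carrier_flats_order[OF \<Delta>] by blast
    qed
  next
    fix x assume "x \<in> carrier (flats_order \<Delta>)"
    then obtain A where A: "set_mset A \<subseteq> ?E" "x = ?\<pi> A"
      unfolding carrier_flats_order[OF \<Delta>] by blast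
    have G: "atoms A \<subseteq> ?G"
      using A(1) unfolding gens_lattice_of_flats[OF \<Delta>] atoms_def by blast
    show "x \<in> insert (verts \<Delta>) {\<Squnion>\<^bsub>?L\<^esub> S | S. S \<noteq> {} \<and> S \<subseteq> ?G}"
    proof (cases "atoms A = {}")
      case True
      have "?\<pi> A = ?\<pi> {#}"
      proof (rule component_partition_cong[OF \<Delta> A(1)])
        show "g \<in># A \<longleftrightarrow> g \<in># {#}" if "proper_uprod g" for g
          using that True unfolding atoms_def by auto
      qed simp
      then show ?thesis using component_partition_empty[OF \<Delta>] A(2) by simp
    next
      case False
      then have "x = \<Squnion>\<^bsub>?L\<^esub> (atoms A)" using sup[OF A(1)] A(2) by simp
      then show ?thesis using False G by blast
    qed
  qed
  show ?thesis
    by (rule gelattice.equality)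
      (simp_all add: gen_by_def carrier[unfolded lattice_of_flats_simps(4)] lattice_of_flats_simps
        Union_verts[OF \<Gamma>] Union_verts[OF \<Delta>])
qed

section \<open>Deleting edges and deleting generators\<close>

lemma component_partition_verts_cong:
  "verts \<Delta> = verts \<Gamma> \<Longrightarrow> component_partition \<Delta> A = component_partition \<Gamma> A"
  by (simp add: component_partition_def connected_rel_def)

lemma labeled_graph_subgraph:
  "labeled_graph V \<Gamma> \<Longrightarrow> verts \<Delta> = verts \<Gamma> \<Longrightarrow> edges \<Delta> \<subseteq># edges \<Gamma> \<Longrightarrow> labeled_graph V \<Delta>"
  unfolding labeled_graph_def by (metis mset_subset_eqD)

text \<open>With equal vertex sets an edge has the same flat in both graphs, so the generators that
  remain are the atoms of \<Delta>. The deleted set is empty if only loops or redundant parallel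
  copies disappear.\<close>

lemma gel_delete_lattice_of_flats:
  assumes \<Gamma>: "labeled_graph V \<Gamma>" and v: "verts \<Delta> = verts \<Gamma>" and e: "edges \<Delta> \<subseteq># edges \<Gamma>"
  shows "gel_delete (lattice_of_flats \<Gamma>) (gens (lattice_of_flats \<Gamma>) - gens (lattice_of_flats \<Delta>)) =
    lattice_of_flats \<Delta>"
proof -
  note \<Delta> = labeled_graph_subgraph[OF assms]
  have E: "set_mset (edges \<Delta>) \<subseteq> set_mset (edges \<Gamma>)" using e by (rule set_mset_mono)
  have "gens (lattice_of_flats \<Delta>) \<subseteq> gens (lattice_of_flats \<Gamma>)"
    unfolding gens_lattice_of_flats[OF \<Gamma>] gens_lattice_of_flats[OF \<Delta>]
      component_partition_verts_cong[OF v] using E by blast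
  then have gens: "gens (lattice_of_flats \<Gamma>) - (gens (lattice_of_flats \<Gamma>) - gens (lattice_of_flats \<Delta>)) =
      gens (lattice_of_flats \<Delta>)" by blast
  have bot: "\<bottom>\<^bsub>lattice_of_flats \<Gamma>\<^esub> = verts \<Delta>"
    using bottom_flats[OF \<Gamma>, of "lattice_of_flats \<Gamma>"] v
    by (simp add: lattice_of_flats_simps Union_verts[OF \<Gamma>])
  have "carrier (flats_order \<Delta>) \<subseteq> carrier (flats_order \<Gamma>)"
    unfolding carrier_flats_order[OF \<Gamma>] carrier_flats_order[OF \<Delta>]
      component_partition_verts_cong[OF v] using E by blast
  then show ?thesis
    unfolding gel_delete_def gens bot by (rule gen_by_lattice_of_flats[OF \<Gamma> \<Delta>])
qed

section \<open>Contracting edges and contracting generators\<close>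

text \<open>\<open>\<Delta>\<close> arises from \<open>\<Gamma>\<close> by contracting the edges in \<open>A\<close>, where \<open>m\<close> sends each old vertex to the
  new vertex that absorbs it.\<close>

definition contracts ::
  "'v set uprod multiset \<Rightarrow> ('v set \<Rightarrow> 'v set) \<Rightarrow> 'v vlgraph \<Rightarrow> 'v vlgraph \<Rightarrow> bool" where
  "contracts A m \<Gamma> \<Delta> \<longleftrightarrow>
     verts \<Delta> = component_partition \<Gamma> A \<and>
     edges \<Delta> = image_mset (map_uprod m) (edges \<Gamma> - A) \<and>
     (\<forall>B \<in> verts \<Gamma>. B \<subseteq> m B \<and> m B \<in> verts \<Delta>)"

context
  fixes V :: "'v set" and \<Gamma> \<Delta> :: "'v vlgraph" and A m
  assumes \<Gamma>: "labeled_graph V \<Gamma>" and A: "A \<subseteq># edges \<Gamma>" and contr: "contracts A m \<Gamma> \<Delta>"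
begin

lemma contracts_labeled_graph: "labeled_graph V \<Delta>"
  unfolding labeled_graph_def
proof (intro conjI ballI)
  show "partition_on V (verts \<Delta>)"
    using contr partition_on_flat[OF \<Gamma>] by (simp add: contracts_def)
  fix f assume "f \<in># edges \<Delta>"
  then obtain e where e: "e \<in># edges \<Gamma>" "f = map_uprod m e"
    using contr by (auto simp: contracts_def dest: in_diffD)
  then show "set_uprod f \<subseteq> verts \<Delta>"
    using labeled_graph_ends[OF \<Gamma> e(1)] contr by (auto simp: contracts_def uprod.set_map)
qed

text \<open>Each \<open>m D\<close> lies in some block of \<open>Q\<close>. A block containing
  \<open>D\<close> shares the nonempty set \<open>D\<close> with it, so the two coincide and the
  block contains \<open>m D\<close>.\<close>

lemma contracts_confines_iff:
  assumes Q: "refines V (verts \<Delta>) Q" and e: "set_uprod e \<subseteq> verts \<Gamma>"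
  shows "confines Q (map_uprod m e) \<longleftrightarrow> confines Q e"
proof (cases e)
  case (Upair B C)
  have QV: "partition_on V Q" using Q by (simp add: refines_def)
  have m: "D \<subseteq> m D" "m D \<in> verts \<Delta>" "D \<noteq> {}" if "D \<in> {B, C}" for D
    using that e contr labeled_graph_partition[OF \<Gamma>]
    unfolding Upair contracts_def partition_on_def by auto
  have "m D \<subseteq> Y" if D: "D \<in> {B, C}" and Y: "Y \<in> Q" "D \<subseteq> Y" for D Y
  proof -
    obtain Z where Z: "Z \<in> Q" "m D \<subseteq> Z" using Q m(2)[OF D] by (auto simp: refines_def)
    then have "Z = Y"
      using partition_on_block_eq[OF QV Z(1) Y(1) m(3)[OF D] _ Y(2)] m(1)[OF D] by blast
    then show ?thesis using Z by simp
  qed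
  then have "(\<exists>Y \<in> Q. m B \<subseteq> Y \<and> m C \<subseteq> Y) \<longleftrightarrow> (\<exists>Y \<in> Q. B \<subseteq> Y \<and> C \<subseteq> Y)"
    using m(1)[of B] m(1)[of C] by (meson insertCI order_trans)
  then show ?thesis by (simp add: Upair confines_Upair)
qed

text \<open>Being coarser than \<open>verts \<Delta>\<close> means being coarser than
  \<open>verts \<Gamma>\<close> and confining \<open>A\<close>, while \<open>m\<close> does not
  affect whether the other edges are confined.\<close>

lemma contracts_component_partition:
  assumes B: "set_mset B \<subseteq> set_mset (edges \<Gamma> - A)"
  shows "component_partition \<Delta> (image_mset (map_uprod m) B) = component_partition \<Gamma> (A + B)"
proof (rule refines_eqI[OF partition_on_flat[OF contracts_labeled_graph] partition_on_flat[OF \<Gamma>]])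
  have A': "set_mset A \<subseteq> set_mset (edges \<Gamma>)" using A by (rule set_mset_mono)
  have B': "set_mset B \<subseteq> set_mset (edges \<Gamma>)" using B by (meson in_diffD subset_iff)
  have AB: "set_mset (A + B) \<subseteq> set_mset (edges \<Gamma>)" using A' B' by simp
  have mB: "set_mset (image_mset (map_uprod m) B) \<subseteq> set_mset (edges \<Delta>)"
    using B contr by (auto simp: contracts_def)
  have v: "verts \<Delta> = component_partition \<Gamma> A" using contr by (simp add: contracts_def)
  fix Q
  have "confines Q (map_uprod m e) \<longleftrightarrow> confines Q e" if "refines V (verts \<Delta>) Q" "e \<in># B" for e
    using contracts_confines_iff[OF that(1) labeled_graph_ends[OF \<Gamma>]] that(2) B' by blast
  then show "refines V (component_partition \<Delta> (image_mset (map_uprod m) B)) Q \<longleftrightarrow>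
      refines V (component_partition \<Gamma> (A + B)) Q"
    unfolding refines_flat_iff[OF contracts_labeled_graph mB] refines_flat_iff[OF \<Gamma> AB]
    using refines_flat_iff[OF \<Gamma> A', of Q] v by auto
qed

text \<open>The contracted atoms join to the flat of \<open>A\<close>, which is
  \<open>verts \<Delta>\<close>. Joining the atom of \<open>e\<close> to it gives the flat of the
  image of \<open>e\<close> in \<Delta>, and discarding \<open>i\<^sub>0\<close> discards the edges
  that became loops.\<close>

lemma gel_contract_lattice_of_flats:
  "gel_contract (lattice_of_flats \<Gamma>) {component_partition \<Gamma> {#e#} | e. e \<in># A \<and> proper_uprod e} =
    lattice_of_flats \<Delta>"
proof -
  let ?L = "lattice_of_flats \<Gamma>" and ?\<pi> = "component_partition \<Gamma>"
  let ?I = "{?\<pi> {#e#} | e. e \<in># A \<and> proper_uprod e}"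
  note \<Delta> = contracts_labeled_graph
  have A': "set_mset A \<subseteq> set_mset (edges \<Gamma>)" using A by (rule set_mset_mono)
  have L: "carrier ?L = carrier (flats_order \<Gamma>)" "le ?L = refines V"
    by (simp_all add: lattice_of_flats_simps Union_verts[OF \<Gamma>])
  have v: "verts \<Delta> = ?\<pi> A" using contr by (simp add: contracts_def)
  have edge: "set_mset {#e#} \<subseteq> set_mset (edges \<Gamma>)" if "e \<in># edges \<Gamma>" for e using that by simp
  have sup: "\<Squnion>\<^bsub>?L\<^esub> ?I = verts \<Delta>"
    unfolding v
  proof (rule sup_flats[OF \<Gamma> L _ A'])
    show "?I \<subseteq> carrier ?L"
      unfolding L(1) carrier_flats_order[OF \<Gamma>] using A' edge by blast
    show "(\<forall>e \<in># A. confines Q e) \<longleftrightarrow> (\<forall>s \<in> ?I. refines V s Q)" if "refines V (verts \<Gamma>) Q" for Q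
      using confines_all_iff_refines_atoms[OF \<Gamma> A' that] .
  qed
  have join: "?\<pi> {#e#} \<squnion>\<^bsub>?L\<^esub> verts \<Delta> = ?\<pi> (A + {#e#})" if "e \<in># edges \<Gamma>" for e
    using join_flats[OF \<Gamma> L edge[OF that] A'] v by simp
  have image: "component_partition \<Delta> {#map_uprod m e#} = ?\<pi> (A + {#e#})" if "e \<in># edges \<Gamma> - A" for e
    using contracts_component_partition[of "{#e#}"] that by simp
  \<comment> \<open>An edge with no copy in \<open>edges \<Gamma> - A\<close> occurs in
    \<open>A\<close>; like a loop, it adds nothing to the flat of \<open>A\<close>.\<close>
  have new: "e \<in># edges \<Gamma> - A \<and> proper_uprod e" if "e \<in># edges \<Gamma>" "?\<pi> (A + {#e#}) \<noteq> ?\<pi> A" for e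
  proof (rule ccontr)
    assume "\<not> ?thesis"
    then have *: "e \<in># A \<or> \<not> proper_uprod e"
      using that(1) by (auto simp: in_diff_count count_eq_zero_iff[symmetric] simp del: count_eq_zero_iff)
    have "?\<pi> (A + {#e#}) = ?\<pi> A"
      by (rule component_partition_cong[OF \<Gamma>]) (use * A' that(1) in auto)
    with that(2) show False by simp
  qed
  have edges: "edges \<Delta> = image_mset (map_uprod m) (edges \<Gamma> - A)"
    using contr by (simp add: contracts_def)
  have gens: "{g \<squnion>\<^bsub>?L\<^esub> verts \<Delta> | g. g \<in> gens ?L} - {verts \<Delta>} = gens (lattice_of_flats \<Delta>)"
  proof (intro equalityI subsetI)
    fix x assume "x \<in> {g \<squnion>\<^bsub>?L\<^esub> verts \<Delta> | g. g \<in> gens ?L} - {verts \<Delta>}"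
    then obtain e where e: "e \<in># edges \<Gamma>" "x = ?\<pi> (A + {#e#})" "x \<noteq> verts \<Delta>"
      using join unfolding gens_lattice_of_flats[OF \<Gamma>] by blast
    then have eA: "e \<in># edges \<Gamma> - A" using new v by blast
    then have f: "map_uprod m e \<in># edges \<Delta>" using edges by simp
    have x: "x = component_partition \<Delta> {#map_uprod m e#}" using image[OF eA] e(2) by simp
    then have "proper_uprod (map_uprod m e)"
      using component_partition_edge_eq_verts_iff[OF \<Delta> f] e(3) by simp
    then show "x \<in> gens (lattice_of_flats \<Delta>)"
      unfolding gens_lattice_of_flats[OF \<Delta>] using x f by blast
  next
    fix x assume "x \<in> gens (lattice_of_flats \<Delta>)"
    then obtain f where f: "f \<in># edges \<Delta>" "proper_uprod f" "x = component_partition \<Delta> {#f#}"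
      unfolding gens_lattice_of_flats[OF \<Delta>] by blast
    then obtain e where e: "e \<in># edges \<Gamma> - A" "f = map_uprod m e" using edges by auto
    have eG: "e \<in># edges \<Gamma>" using e(1) by (rule in_diffD)
    have x: "x = ?\<pi> (A + {#e#})" "x \<noteq> verts \<Delta>"
      using image[OF e(1)] e(2) f component_partition_edge_eq_verts_iff[OF \<Delta> f(1)] by simp_all
    then have "proper_uprod e" using new[OF eG] v by blast
    then have "?\<pi> {#e#} \<in> gens ?L" unfolding gens_lattice_of_flats[OF \<Gamma>] using eG by blast
    then show "x \<in> {g \<squnion>\<^bsub>?L\<^esub> verts \<Delta> | g. g \<in> gens ?L} - {verts \<Delta>}"
      using x join[OF eG] by blast
  qed
  have "carrier (flats_order \<Delta>) \<subseteq> carrier (flats_order \<Gamma>)"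
  proof
    fix x assume "x \<in> carrier (flats_order \<Delta>)"
    then obtain B where B: "set_mset B \<subseteq> set_mset (edges \<Delta>)" "x = component_partition \<Delta> B"
      unfolding carrier_flats_order[OF \<Delta>] by blast
    \<comment> \<open>The surviving edges with image in \<open>B\<close>. Only their set matters, so
      the multiplicities of \<open>C\<close> are left open.\<close>
    obtain C where C: "set_mset C = {e \<in> set_mset (edges \<Gamma> - A). map_uprod m e \<in># B}"
      using set_mset_filter by metis
    then have "set_mset (image_mset (map_uprod m) C) = set_mset B" using B(1) edges by auto
    then have "x = component_partition \<Delta> (image_mset (map_uprod m) C)"
      unfolding B(2) using B(1) by (intro component_partition_cong[OF \<Delta>]) simp_all
    also have "\<dots> = ?\<pi> (A + C)" by (rule contracts_component_partition) (simp add: C)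
    finally have "x = ?\<pi> (A + C)" .
    moreover have "set_mset (A + C) \<subseteq> set_mset (edges \<Gamma>)" using A' C by (auto dest: in_diffD)
    ultimately show "x \<in> carrier (flats_order \<Gamma>)" unfolding carrier_flats_order[OF \<Gamma>] by blast
  qed
  then show ?thesis
    unfolding gel_contract_def sup Let_def gens by (rule gen_by_lattice_of_flats[OF \<Gamma> \<Delta>])
qed

end

section \<open>Composing single edge deletions and contractions\<close>

lemma add_mset_subset_eqD:
  assumes "add_mset e A \<subseteq># M"
  shows "A \<subseteq># M \<and> e \<in># M - A"
proof
  show "A \<subseteq># M"
    using subset_mset.order_trans[OF mset_subset_eq_add_right[of A "{#e#}"]] assms by simp
  show "e \<in># M - A"
    using mset_subset_eq_count[OF assms, of e] by (simp add: in_diff_count)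
qed

text \<open>After contracting \<open>A\<close>, a remaining copy of \<open>e\<close> has become
  \<open>map_uprod m e\<close>; contracting it composes the two vertex maps. This is the induction
  step for contracting many edges.\<close>

lemma contracts_contract_edge:
  assumes \<Gamma>: "labeled_graph V \<Gamma>" and A: "add_mset e A \<subseteq># edges \<Gamma>" and contr: "contracts A m \<Gamma> \<Delta>"
  shows "map_uprod m e \<in># edges \<Delta>"
    and "contracts (add_mset e A) (merge_ends (map_uprod m e) \<circ> m) \<Gamma>
      (contract_edge (map_uprod m e) \<Delta>)"
proof -
  let ?e = "map_uprod m e"
  have A': "A \<subseteq># edges \<Gamma>" and e: "e \<in># edges \<Gamma> - A"
    using add_mset_subset_eqD[OF A] by blast+
  note \<Delta> = contracts_labeled_graph[OF \<Gamma> A' contr]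
  have edges: "edges \<Delta> = image_mset (map_uprod m) (edges \<Gamma> - A)"
    using contr by (simp add: contracts_def)
  show e': "?e \<in># edges \<Delta>" using e edges by simp
  have "merge_ends ?e ` verts \<Delta> = component_partition \<Gamma> (add_mset e A)"
    using component_partition_edge[OF \<Delta> e'] contracts_component_partition[OF \<Gamma> A' contr, of "{#e#}"] e
    by simp
  moreover have "image_mset (map_uprod (merge_ends ?e)) (edges \<Delta> - {#?e#}) =
      image_mset (map_uprod (merge_ends ?e \<circ> m)) (edges \<Gamma> - add_mset e A)"
  proof -
    \<comment> \<open>Splitting off one copy of \<open>e\<close> reduces both multiset differences
      to \<open>C\<close>.\<close>
    obtain C where C: "edges \<Gamma> - A = add_mset e C" using e by (meson multi_member_split)
    have "edges \<Gamma> - add_mset e A = edges \<Gamma> - A - {#e#}" by simp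
    also have "\<dots> = C" unfolding C by simp
    finally have "edges \<Gamma> - add_mset e A = C" .
    moreover have "edges \<Delta> - {#?e#} = image_mset (map_uprod m) C" by (simp add: edges C)
    ultimately show ?thesis by (simp add: multiset.map_comp comp_def uprod.map_comp)
  qed
  moreover have "B \<subseteq> merge_ends ?e (m B) \<and> merge_ends ?e (m B) \<in> merge_ends ?e ` verts \<Delta>"
    if "B \<in> verts \<Gamma>" for B
  proof -
    have "B \<subseteq> m B" "m B \<in> verts \<Delta>" using contr that unfolding contracts_def by blast+
    moreover have "m B \<subseteq> merge_ends ?e (m B)" by (auto simp: merge_ends_def)
    ultimately show ?thesis by blast
  qed
  ultimately show "contracts (add_mset e A) (merge_ends ?e \<circ> m) \<Gamma> (contract_edge ?e \<Delta>)"
    by (simp add: contracts_def contract_edge_def)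
qed

lemma contracts_empty: "labeled_graph V \<Gamma> \<Longrightarrow> contracts {#} id \<Gamma> \<Gamma>"
  by (simp add: contracts_def component_partition_empty uprod.map_id0)

text \<open>The edges of \<open>A\<close> are contracted one by one, each through its current image,
  which may already be a loop.\<close>

lemma vl_minor_contracts:
  assumes "labeled_graph V \<Gamma>" "A \<subseteq># edges \<Gamma>"
  shows "\<exists>m \<Delta>. contracts A m \<Gamma> \<Delta> \<and> vl_minor \<Gamma> \<Delta>"
  using assms(2)
proof (induction A)
  case empty
  then show ?case using contracts_empty[OF assms(1)] vl_minor.self by blast
next
  case (add e A)
  then obtain m \<Delta> where "contracts A m \<Gamma> \<Delta>" "vl_minor \<Gamma> \<Delta>"
    using add.IH add_mset_subset_eqD[OF add.prems] by blast
  then show ?case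
    using contracts_contract_edge[OF assms(1) add.prems] vl_minor.contraction by blast
qed

lemma vl_minor_delete_edges:
  "B \<subseteq># edges \<Gamma> \<Longrightarrow> vl_minor \<Gamma> (\<Gamma>\<lparr>edges := edges \<Gamma> - B\<rparr>)"
proof (induction B)
  case empty
  then show ?case by (simp add: vl_minor.self)
next
  case (add e B)
  have "B \<subseteq># edges \<Gamma>" "e \<in># edges \<Gamma> - B"
    using add_mset_subset_eqD[OF add.prems] by blast+
  then have "vl_minor \<Gamma> (delete_edge e (\<Gamma>\<lparr>edges := edges \<Gamma> - B\<rparr>))"
    using add.IH by (intro vl_minor.deletion) simp_all
  then show ?case by (simp add: delete_edge_def)
qed

lemma vl_minor_trans: "vl_minor H K \<Longrightarrow> vl_minor \<Gamma> H \<Longrightarrow> vl_minor \<Gamma> K"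
  by (induction rule: vl_minor.induct) (auto intro: vl_minor.intros)

lemma vl_minor_restrict_edges:
  assumes "D \<subseteq># edges \<Gamma>"
  shows "vl_minor \<Gamma> (\<Gamma>\<lparr>edges := D\<rparr>)"
proof -
  have "edges \<Gamma> - (edges \<Gamma> - D) = D"
    using assms by (metis add_diff_cancel_right' subset_mset.add_diff_inverse)
  then show ?thesis using vl_minor_delete_edges[of "edges \<Gamma> - D" \<Gamma>] by simp
qed

section \<open>Translating minors in both directions\<close>

text \<open>Each graph step is one lattice step, possibly with an empty set of generators, as for a
  loop. The labeling invariant is carried along because the next step needs it.\<close>

lemma vl_minor_imp_gel_minor:
  assumes "vl_minor \<Gamma> H" and \<Gamma>: "labeled_graph V \<Gamma>"
  shows "labeled_graph V H \<and> gel_minor (lattice_of_flats \<Gamma>) (lattice_of_flats H)"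
  using assms(1)
proof (induction rule: vl_minor.induct)
  case self
  then show ?case using \<Gamma> gel_minor.self by blast
next
  case (deletion H e)
  then have H: "labeled_graph V H" by blast
  have sub: "verts (delete_edge e H) = verts H" "edges (delete_edge e H) \<subseteq># edges H"
    by (simp_all add: delete_edge_def)
  have "gel_minor (lattice_of_flats \<Gamma>) (gel_delete (lattice_of_flats H)
      (gens (lattice_of_flats H) - gens (lattice_of_flats (delete_edge e H))))"
    using deletion.IH by (intro gel_minor.deletion) auto
  then show ?case
    unfolding gel_delete_lattice_of_flats[OF H sub] using labeled_graph_subgraph[OF H sub] by blast
next
  case (contraction H e)
  then have H: "labeled_graph V H" by blast
  have e: "{#e#} \<subseteq># edges H" using contraction.hyps by simp
  have contr: "contracts {#e#} (merge_ends e) H (contract_edge e H)"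
    using contracts_contract_edge(2)[OF H e contracts_empty[OF H]] by (simp add: uprod.map_id0)
  have "gel_minor (lattice_of_flats \<Gamma>) (gel_contract (lattice_of_flats H)
      {component_partition H {#f#} | f. f \<in># {#e#} \<and> proper_uprod f})"
    using contraction by (intro gel_minor.contraction) (auto simp: gens_lattice_of_flats[OF H])
  then show ?case
    unfolding gel_contract_lattice_of_flats[OF H e contr]
    using contracts_labeled_graph[OF H e contr] by blast
qed

text \<open>Generators are atoms, so a set \<open>I\<close> of them is realized by the edges whose
  flats lie in \<open>I\<close>.\<close>

lemma gel_minor_imp_vl_minor:
  assumes "gel_minor (lattice_of_flats \<Gamma>) M" and \<Gamma>: "labeled_graph V \<Gamma>"
  shows "\<exists>H. vl_minor \<Gamma> H \<and> M = lattice_of_flats H"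
  using assms(1)
proof (induction rule: gel_minor.induct)
  case self
  then show ?case using vl_minor.self by blast
next
  case (deletion M I)
  then obtain H where H: "vl_minor \<Gamma> H" "M = lattice_of_flats H" by blast
  have lH: "labeled_graph V H" using vl_minor_imp_gel_minor[OF H(1) \<Gamma>] by blast
  \<comment> \<open>Parallel edges share an atom, so whole parallel classes are deleted; loops stay,
    as their flat is the bottom.\<close>
  define K where "K = H\<lparr>edges := filter_mset (\<lambda>e. component_partition H {#e#} \<notin> I) (edges H)\<rparr>"
  have K: "verts K = verts H" "edges K \<subseteq># edges H" by (simp_all add: K_def)
  have "gens (lattice_of_flats K) = gens (lattice_of_flats H) - I"
    unfolding gens_lattice_of_flats[OF lH] gens_lattice_of_flats[OF labeled_graph_subgraph[OF lH K]]
      component_partition_verts_cong[OF K(1)]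
    by (auto simp: K_def)
  then have "gens (lattice_of_flats H) - gens (lattice_of_flats K) = I"
    using deletion.hyps H(2) by blast
  then have "gel_delete M I = lattice_of_flats K"
    using gel_delete_lattice_of_flats[OF lH K] H(2) by simp
  moreover have "vl_minor \<Gamma> K"
    using vl_minor_trans[OF vl_minor_restrict_edges H(1)] by (simp add: K_def)
  ultimately show ?case by blast
next
  case (contraction M I)
  then obtain H where H: "vl_minor \<Gamma> H" "M = lattice_of_flats H" by blast
  have lH: "labeled_graph V H" using vl_minor_imp_gel_minor[OF H(1) \<Gamma>] by blast
  \<comment> \<open>Again whole parallel classes: after the first copy is contracted, the others are
    contracted as loops.\<close>
  let ?A = "filter_mset (\<lambda>e. component_partition H {#e#} \<in> I) (edges H)"
  have A: "?A \<subseteq># edges H" by simp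
  obtain m K where K: "contracts ?A m H K" "vl_minor H K"
    using vl_minor_contracts[OF lH A] by blast
  have "{component_partition H {#e#} | e. e \<in># ?A \<and> proper_uprod e} = I"
    using contraction.hyps unfolding H(2) gens_lattice_of_flats[OF lH] by auto
  then have "gel_contract M I = lattice_of_flats K"
    using gel_contract_lattice_of_flats[OF lH A K(1)] H(2) by simp
  moreover have "vl_minor \<Gamma> K" using vl_minor_trans[OF K(2) H(1)] .
  ultimately show ?case by blast
qed

section \<open>Simplification, and recovery of a simple graph from its lattice\<close>

lemma simple_vl_minor_exists:
  assumes \<Gamma>: "labeled_graph V \<Gamma>"
  shows "\<exists>H. vl_minor \<Gamma> H \<and> simple_graph H \<and> lattice_of_flats H = lattice_of_flats \<Gamma>"
proof -
  \<comment> \<open>\<open>mset_set\<close> keeps exactly one copy from each parallel class of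
    proper edges.\<close>
  define D where "D = mset_set {e \<in> set_mset (edges \<Gamma>). proper_uprod e}"
  define H where "H = \<Gamma>\<lparr>edges := D\<rparr>"
  have set_D: "set_mset D = {e \<in> set_mset (edges \<Gamma>). proper_uprod e}" by (simp add: D_def)
  have D: "D \<subseteq># edges \<Gamma>"
    by (rule mset_subset_eqI) (auto simp: D_def count_mset_set')
  have v: "verts H = verts \<Gamma>" and e: "edges H = D" by (simp_all add: H_def)
  have lH: "labeled_graph V H" using labeled_graph_subgraph[OF \<Gamma> v] D e by simp
  have "\<exists>B. component_partition \<Gamma> A = component_partition \<Gamma> B \<and> set_mset B \<subseteq> set_mset D"
    if "set_mset A \<subseteq> set_mset (edges \<Gamma>)" for A
  proof (intro exI conjI)
    let ?B = "filter_mset proper_uprod A"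
    show "component_partition \<Gamma> A = component_partition \<Gamma> ?B"
      using that by (intro component_partition_cong[OF \<Gamma>]) auto
    show "set_mset ?B \<subseteq> set_mset D" using that by (auto simp: set_D)
  qed
  then have "carrier (flats_order H) = carrier (flats_order \<Gamma>)"
    unfolding carrier_flats_order[OF lH] carrier_flats_order[OF \<Gamma>] e
      component_partition_verts_cong[OF v]
    using set_mset_mono[OF D] by blast
  then have "flats_order H = flats_order \<Gamma>" by (simp add: flats_order_def v)
  then have "lattice_of_flats H = lattice_of_flats \<Gamma>" by (simp add: lattice_of_flats_def)
  moreover have "simple_graph H"
    unfolding simple_graph_def e set_D by (auto simp: D_def count_mset_set')
  moreover have "vl_minor \<Gamma> H" using vl_minor_restrict_edges[OF D] by (simp add: H_def)
  ultimately show ?thesis by blast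
qed

text \<open>The bottom gives the vertices. The generators give the edges, since the flat of one edge
  confines no other proper edge.\<close>

lemma lattice_of_flats_inject:
  fixes H K :: "'v vlgraph"
  assumes H: "labeled_graph V H" "simple_graph H" and K: "labeled_graph V K" "simple_graph K"
    and eq: "lattice_of_flats H = lattice_of_flats K"
  shows "H = K"
proof -
  have bot: "\<bottom>\<^bsub>lattice_of_flats G\<^esub> = verts G" if "labeled_graph V G" for G
    using bottom_flats[OF that, of "lattice_of_flats G"]
    by (simp add: lattice_of_flats_simps Union_verts[OF that])
  have v: "verts H = verts K" using bot[OF H(1)] bot[OF K(1)] eq by simp
  \<comment> \<open>Stated for arbitrary \<open>G\<close> and \<open>G'\<close> so that it serves
    both inclusions.\<close>
  have "e \<in># edges G'"
    if G: "labeled_graph V G" "simple_graph G" and G': "labeled_graph V G'"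
      and gens: "gens (lattice_of_flats G) = gens (lattice_of_flats G')"
      and vG: "verts G = verts G'" and e: "e \<in># edges G" for G G' :: "'v vlgraph" and e
  proof -
    have pr: "proper_uprod e" using G(2) e by (simp add: simple_graph_def)
    then have "component_partition G {#e#} \<in> gens (lattice_of_flats G')"
      using e unfolding gens[symmetric] gens_lattice_of_flats[OF G(1)] by blast
    then obtain f where f: "f \<in># edges G'" "component_partition G {#e#} = component_partition G' {#f#}"
      unfolding gens_lattice_of_flats[OF G'] by blast
    have "confines (component_partition G' {#f#}) e"
      using confines_flat[OF G(1), of e "{#e#}"] e f(2) by simp
    then have "e = f"
      using confines_component_partition_edge[OF G' f(1) _ pr] labeled_graph_ends[OF G(1) e] vG by simp
    then show ?thesis using f(1) by simp
  qed
  then have "set_mset (edges H) = set_mset (edges K)"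
    using H K eq v by (intro equalityI subsetI) metis+
  \<comment> \<open>Multiplicities in a simple graph are 0 or 1, so the set of edges determines the
    multiset.\<close>
  moreover have "count (edges G) e = (if e \<in># edges G then 1 else 0)" if "simple_graph G" for G :: "'v vlgraph" and e
    using that count_greater_eq_one_iff[of "edges G" e] unfolding simple_graph_def
    by (auto simp: not_in_iff intro: le_antisym)
  ultimately have "edges H = edges K"
    using H(2) K(2) by (intro multiset_eqI) simp
  with v show ?thesis by simp
qed

lemma labeled_graph_singleton_labeled:
  assumes "\<And>e. e \<in># E \<Longrightarrow> set_uprod e \<subseteq> V"
  shows "labeled_graph V (singleton_labeled V E)"
  unfolding labeled_graph_def singleton_labeled_def
  using assms by (auto simp: uprod.set_map partition_on_def disjoint_def)

theorem mainTheorem10: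
  fixes V :: "'v set" and E :: "'v uprod multiset"
  assumes "finite V"
    and "\<And>e. e \<in># E \<Longrightarrow> set_uprod e \<subseteq> V"
  shows "bij_betw lattice_of_flats
           {H. vl_minor (singleton_labeled V E) H \<and> simple_graph H}
           {M. gel_minor (lattice_of_flats (singleton_labeled V E)) M}"
proof -
  let ?G = "singleton_labeled V E"
  have G: "labeled_graph V ?G" using assms(2) by (rule labeled_graph_singleton_labeled)
  show ?thesis
  proof (rule bij_betw_imageI)
    show "inj_on lattice_of_flats {H. vl_minor ?G H \<and> simple_graph H}"
      using vl_minor_imp_gel_minor[OF _ G] lattice_of_flats_inject by (intro inj_onI) blast
    show "lattice_of_flats ` {H. vl_minor ?G H \<and> simple_graph H} =
        {M. gel_minor (lattice_of_flats ?G) M}"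
    proof (intro equalityI subsetI)
      fix M assume "M \<in> lattice_of_flats ` {H. vl_minor ?G H \<and> simple_graph H}"
      then show "M \<in> {M. gel_minor (lattice_of_flats ?G) M}"
        using vl_minor_imp_gel_minor[OF _ G] by blast
    next
      fix M assume "M \<in> {M. gel_minor (lattice_of_flats ?G) M}"
      then obtain H where H: "vl_minor ?G H" "M = lattice_of_flats H"
        using gel_minor_imp_vl_minor[OF _ G] by blast
      \<comment> \<open>\<open>H\<close> may have loops or parallel edges; its simplification
        \<open>K\<close> is still a minor and has the same lattice.\<close>
      then obtain K where "vl_minor H K" "simple_graph K" "lattice_of_flats K = M"
        using vl_minor_imp_gel_minor[OF H(1) G] simple_vl_minor_exists by metis
      then show "M \<in> lattice_of_flats ` {H. vl_minor ?G H \<and> simple_graph H}"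
        using vl_minor_trans[OF _ H(1)] by blast
    qed
  qed
qed

end
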